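(* Let $\mathbb{T}=\{z\in\mathbb{C}:|z|=1\}$ and let $\mathcal{E}_c$ be an ellipse nested inside $\mathbb{T}$, with foci $f,g\in\mathbb{C}\setminus\{0\}$, such that there is a Poncelet family of triangles inscribed in $\mathbb{T}$ and circumscribing $\mathcal{E}_c$. Suppose that $1/f+1/g$ lies on $\mathbb{T}$ (equivalently, that the family contains an equilateral triangle). Then, over the whole Poncelet family, the focus $X_{110}$ of the Kiepert parabola is stationary at $(1/f+1/g)^{-1}$; that is, for every non-equilateral triangle in the family, the focus of its Kiepert parabola is the point $(1/f+1/g)^{-1}\in\mathbb{C}$.
   Context: The plane is identified with $\mathbb{C}$. A Poncelet family of triangles inscribed in $\mathbb{T}$ and circumscribing $\mathcal{E}_c$ is the one-parameter family of all triangles with vertices on $\mathbb{T}$ and with all three sides tangent to $\mathcal{E}_c$, where $\mathcal{E}_c$ is such that every point of $\mathbb{T}$ is a vertex of such a triangle. A circle counts as an ellipse with coincident foci. The Kiepert parabola of a (non-equilateral) triangle is the parabola tangent to the three side lines of the triangle and having the Euler line of the triangle (the line through the barycenter $X_2$ and the circumcenter $X_3$) as its directrix. Its focus, denoted $X_{110}$, lies on the circumcircle of the triangle.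
   Formalization: For an isosceles non-equilateral triangle no parabola tangent to all three sides has the Euler line as directrix; there the focus is defined by the degenerate condition: the point of the Euler line lying on each side not perpendicular to that line (the apex). Scalene triangles are unchanged. *)

theory Defs
  imports "HOL-Analysis.Analysis"
begin

definition line_through :: "complex \<Rightarrow> complex \<Rightarrow> complex set" where
  "line_through p q = affine hull {p, q}"

definition perpendicular :: "complex set \<Rightarrow> complex set \<Rightarrow> bool" where
  "perpendicular L M \<longleftrightarrow>
     (\<forall>x\<in>L. \<forall>y\<in>L. \<forall>u\<in>M. \<forall>v\<in>M. orthogonal (x - y) (u - v))"

(* L is tangent to C if it passes through a point of C in the direction of a nonzero velocity
   vector, at that point, of a curve lying in C.  For a smooth curve such as an ellipse or a
   nondegenerate parabola these are exactly the usual tangent lines. (Demanding just one common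
   point would also admit the lines parallel to the axis of a parabola.) *)
definition tangent_line :: "complex set \<Rightarrow> complex set \<Rightarrow> bool" where
  "tangent_line C L \<longleftrightarrow>
     (\<exists>(\<gamma> :: real \<Rightarrow> complex) t d. range \<gamma> \<subseteq> C \<and> d \<noteq> 0 \<and>
        (\<gamma> has_vector_derivative d) (at t) \<and> L = range (\<lambda>s. \<gamma> t + s *\<^sub>R d))"

(* An ellipse proper when dist f g < r; r is the length of the major axis. If f = g, it is the
   circle of radius r / 2. *)
definition ellipse :: "complex \<Rightarrow> complex \<Rightarrow> real \<Rightarrow> complex set" where
  "ellipse f g r = {z. dist z f + dist z g = r}"

(* A parabola proper when F is not on the line D. *)
definition parabola :: "complex \<Rightarrow> complex set \<Rightarrow> complex set" where
  "parabola F D = {z. dist z F = infdist z D}"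

definition triangle :: "complex \<Rightarrow> complex \<Rightarrow> complex \<Rightarrow> bool" where
  "triangle a b c \<longleftrightarrow> \<not> collinear {a, b, c}"

definition equilateral :: "complex \<Rightarrow> complex \<Rightarrow> complex \<Rightarrow> bool" where
  "equilateral a b c \<longleftrightarrow> dist a b = dist b c \<and> dist b c = dist c a"

definition side_lines :: "complex \<Rightarrow> complex \<Rightarrow> complex \<Rightarrow> complex set set" where
  "side_lines a b c = {line_through a b, line_through b c, line_through c a}"

definition barycenter :: "complex \<Rightarrow> complex \<Rightarrow> complex \<Rightarrow> complex" where
  "barycenter a b c = (a + b + c) / 3"

definition circumcenter :: "complex \<Rightarrow> complex \<Rightarrow> complex \<Rightarrow> complex" where
  "circumcenter a b c = (THE x. dist x a = dist x b \<and> dist x b = dist x c)"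

(* A line only for non-equilateral triangles. *)
definition euler_line :: "complex \<Rightarrow> complex \<Rightarrow> complex \<Rightarrow> complex set" where
  "euler_line a b c = line_through (barycenter a b c) (circumcenter a b c)"

definition poncelet_triangle :: "complex set \<Rightarrow> complex \<Rightarrow> complex \<Rightarrow> complex \<Rightarrow> bool" where
  "poncelet_triangle E a b c \<longleftrightarrow>
     triangle a b c \<and> {a, b, c} \<subseteq> sphere 0 1 \<and> (\<forall>L\<in>side_lines a b c. tangent_line E L)"

definition poncelet_family :: "complex set \<Rightarrow> bool" where
  "poncelet_family E \<longleftrightarrow> (\<forall>a\<in>sphere 0 1. \<exists>b c. poncelet_triangle E a b c)"

(* F is the focus of a parabola tangent to the three side lines, with the Euler line as
   directrix. *)
definition kiepert_parabola_focus :: "complex \<Rightarrow> complex \<Rightarrow> complex \<Rightarrow> complex \<Rightarrow> bool" where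
  "kiepert_parabola_focus a b c F \<longleftrightarrow>
     F \<notin> euler_line a b c \<and>
     (\<forall>L\<in>side_lines a b c. tangent_line (parabola F (euler_line a b c)) L)"

(* An isosceles, non-equilateral triangle has no proper Kiepert parabola: the focus moves onto
   the Euler line, and the parabola degenerates. As a focus F approaches a point of the
   directrix D, the limits of the tangent lines of the parabola are exactly the lines through F
   and the lines perpendicular to D. A non-equilateral triangle has all its side lines of this
   kind, for some F on its Euler line, only if it is isosceles, and then F is its apex. *)
definition degenerate_kiepert_focus :: "complex \<Rightarrow> complex \<Rightarrow> complex \<Rightarrow> complex \<Rightarrow> bool" where
  "degenerate_kiepert_focus a b c F \<longleftrightarrow>
     F \<in> euler_line a b c \<and>
     (\<forall>L\<in>side_lines a b c. F \<in> L \<or> perpendicular L (euler_line a b c))"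

definition is_X110 :: "complex \<Rightarrow> complex \<Rightarrow> complex \<Rightarrow> complex \<Rightarrow> bool" where
  "is_X110 a b c F \<longleftrightarrow>
     kiepert_parabola_focus a b c F \<or> degenerate_kiepert_focus a b c F"

end

theory Submission
  imports Defs
begin

text \<open>Write $h = a + b + c$, $e = ab + bc + ca$, $p = abc$ for a triangle on the unit circle. A line is
  tangent to an ellipse exactly when the product of the signed distances of the foci $f, g$ to it is
  the square of the semi-minor axis. Hence the foci are isogonal conjugates in every triangle of the
  family, which amounts to $h = f + g + p \overline{fg}$ and, conjugating, $e = fg + p \overline{f + g}$.
  The triangle is equilateral iff $h = 0$. Otherwise a parabola is tangent to a line iff the
  reflection of its focus in the line is on the directrix, and with the Euler line $\mathbb{R} h$ as
  directrix this gives the focus $e / h$. If $X = fg / (f + g)$ is unimodular, then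
  $X \overline{fg} = \overline{f + g}$, so $e = X h$ for every triangle of the family.\<close>

section \<open>Chords of the unit circle\<close>

text \<open>Since conjugation is inversion on the circle, clearing denominators in the reality of
  \<open>(z - a) / (b - a)\<close> gives this equation. It is polynomial in \<open>z\<close> and
  \<open>cnj z\<close>, which makes later incidence arguments accessible to
  \<open>algebra\<close>.\<close>

lemma line_through_unit_circle:
  fixes a b :: complex
  assumes "norm a = 1" "norm b = 1" "a \<noteq> b"
  shows "line_through a b = {z. z + a * b * cnj z = a + b}"
proof -
  have ca: "a * cnj a = 1" "b * cnj b = 1"
    using assms by (simp_all add: complex_norm_square[symmetric])
  have "z \<in> line_through a b \<longleftrightarrow> z + a * b * cnj z = a + b" for z
  proof
    assume "z \<in> line_through a b"
    then obtain u where z: "z = a + u *\<^sub>R (b - a)"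
      unfolding line_through_def affine_hull_2_alt by blast
    show "z + a * b * cnj z = a + b"
      unfolding z scaleR_conv_of_real using ca by (simp, algebra)
  next
    assume z: "z + a * b * cnj z = a + b"
    define w where "w = (z - a) / (b - a)"
    have ne: "b - a \<noteq> 0" "cnj b - cnj a \<noteq> 0" "a \<noteq> 0" "b \<noteq> 0"
      using assms by (auto simp flip: complex_cnj_diff)
    have "a * b * ((cnj z - cnj a) * (b - a)) = a * b * ((z - a) * (cnj b - cnj a))"
      using z ca by algebra
    then have "cnj w = w"
      unfolding w_def using ne by (simp add: frac_eq_eq)
    then have "w = of_real (Re w)"
      by (simp add: complex_eq_iff)
    then have "z = a + Re w *\<^sub>R (b - a)"
      using ne(1) unfolding scaleR_conv_of_real by (metis w_def add_diff_cancel_left' add_diff_eq nonzero_eq_divide_eq)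
    then show "z \<in> line_through a b"
      unfolding line_through_def affine_hull_2_alt by blast
  qed
  then show ?thesis by blast
qed

text \<open>Links chords to the parametrized lines in \<open>tangent_line\<close>: the base point
  solves the equation of the chord, and the direction solves its homogeneous version, which fixes it
  up to a real factor.\<close>

lemma line_through_unit_circle_eq_range:
  fixes a b p d :: complex
  assumes "norm a = 1" "norm b = 1" "a \<noteq> b" "d \<noteq> 0"
  shows "line_through a b = range (\<lambda>s. p + s *\<^sub>R d) \<longleftrightarrow>
    p + a * b * cnj p = a + b \<and> d + a * b * cnj d = 0"
  unfolding line_through_unit_circle[OF assms(1-3)]
proof
  assume eq: "{z. z + a * b * cnj z = a + b} = range (\<lambda>s. p + s *\<^sub>R d)"
  have "p + s *\<^sub>R d \<in> {z. z + a * b * cnj z = a + b}" for s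
    unfolding eq by blast
  from this[of 0] this[of 1] have "p + a * b * cnj p = a + b" "p + d + a * b * (cnj p + cnj d) = a + b"
    by auto
  then show "p + a * b * cnj p = a + b \<and> d + a * b * cnj d = 0"
    by algebra
next
  assume h: "p + a * b * cnj p = a + b \<and> d + a * b * cnj d = 0"
  have "\<exists>s. z = p + s *\<^sub>R d" if z: "z + a * b * cnj z = a + b" for z
  proof -
    define w where "w = (z - p) / d"
    have "d * (a * b * (cnj z - cnj p)) = d * (- (z - p))" "a * b * cnj d = - d"
      using h z by (algebra, algebra)
    then have "(a * b) * ((cnj z - cnj p) * d) = (a * b) * ((z - p) * cnj d)"
      by (simp add: algebra_simps)
    then have "(cnj z - cnj p) * d = (z - p) * cnj d"
      using assms by auto
    then have "cnj w = w"
      unfolding w_def using assms(4) by (simp add: frac_eq_eq)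
    then have "w = of_real (Re w)"
      by (simp add: complex_eq_iff)
    then have "z = p + Re w *\<^sub>R d"
      using assms(4) unfolding scaleR_conv_of_real by (metis w_def add_diff_cancel_left' add_diff_eq nonzero_eq_divide_eq)
    then show ?thesis by blast
  qed
  moreover have "p + s *\<^sub>R d + a * b * cnj (p + s *\<^sub>R d) = a + b" for s
    using h unfolding scaleR_conv_of_real by (simp, algebra)
  ultimately show "{z. z + a * b * cnj z = a + b} = range (\<lambda>s. p + s *\<^sub>R d)"
    by blast
qed

section \<open>Tangents of an ellipse and their distances from the foci\<close>

text \<open>\<open>Im ((\<gamma> t - f) * cnj d) / norm d\<close> is a signed distance of
  \<open>f\<close> from the tangent, and the difference of squares on the right is four times the
  squared semi-minor axis. Differentiating the constant sum of focal distances gives the reflection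
  law, from which the product of the distances follows up to sign.\<close>

lemma ellipse_tangent_product:
  fixes f g d :: complex
  assumes r: "dist f g < r" and E: "range \<gamma> \<subseteq> ellipse f g r"
    and \<gamma>: "(\<gamma> has_vector_derivative d) (at t)" and "d \<noteq> 0"
  shows "4 * Im ((\<gamma> t - f) * cnj d) * Im ((\<gamma> t - g) * cnj d) = (r\<^sup>2 - (dist f g)\<^sup>2) * (norm d)\<^sup>2"
proof -
  define w v where "w = \<gamma> t - f" and "v = \<gamma> t - g"
  have sum: "norm (\<gamma> s - f) + norm (\<gamma> s - g) = r" for s
    using E by (auto simp: ellipse_def dist_norm)
  have wv: "norm w + norm v = r" "dist f g = norm (v - w)"
    using sum by (auto simp: w_def v_def dist_norm)
  then have ne: "w \<noteq> 0" "v \<noteq> 0"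
    using r by auto
  have "((\<lambda>s. norm (\<gamma> s - z)) has_derivative (\<lambda>h. (h *\<^sub>R d) \<bullet> sgn (\<gamma> t - z))) (at t)"
    if "\<gamma> t - z \<noteq> 0" for z
  proof -
    have "((\<lambda>s. \<gamma> s - z) has_derivative (\<lambda>h. h *\<^sub>R d)) (at t)"
      using \<gamma> unfolding has_vector_derivative_def by (auto intro!: derivative_eq_intros)
    from has_derivative_compose[OF this has_derivative_norm[OF that]] show ?thesis .
  qed
  from has_derivative_add[OF this this, of f g]
  have "((\<lambda>s. norm (\<gamma> s - f) + norm (\<gamma> s - g)) has_derivative
      (\<lambda>h. (h *\<^sub>R d) \<bullet> sgn w + (h *\<^sub>R d) \<bullet> sgn v)) (at t)"
    using ne unfolding w_def v_def by blast
  moreover have "((\<lambda>s. norm (\<gamma> s - f) + norm (\<gamma> s - g)) has_derivative (\<lambda>h. 0)) (at t)"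
    unfolding sum by simp
  ultimately have "(\<lambda>h. (h *\<^sub>R d) \<bullet> sgn w + (h *\<^sub>R d) \<bullet> sgn v) = (\<lambda>h. 0)"
    by (rule has_derivative_unique)
  then have "d \<bullet> sgn w + d \<bullet> sgn v = 0"
    by (metis scaleR_one)
  then have rel: "(d \<bullet> w) * norm v + (d \<bullet> v) * norm w = 0"
    using ne by (simp add: sgn_div_norm field_simps)
  \<comment> \<open>By the reflection law the unit vectors \<open>w / A\<close> and
    \<open>v / B\<close> have opposite inner products with \<open>d\<close>, namely
    \<open>\<tau>\<close> and \<open>- \<tau>\<close>.\<close>
  define A B N \<tau> where "A = norm w" and "B = norm v" and "N = (norm d)\<^sup>2" and "\<tau> = Re (w * cnj d) / A"
  define x y where "x = Im (w * cnj d)" and "y = Im (v * cnj d)"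
  have AB: "A > 0" "B > 0" "N > 0"
    using ne \<open>d \<noteq> 0\<close> by (auto simp: A_def B_def N_def)
  have Rw: "Re (w * cnj d) = A * \<tau>"
    using AB by (simp add: \<tau>_def)
  have "(d \<bullet> w) = Re (w * cnj d)" "(d \<bullet> v) = Re (v * cnj d)"
    by (simp_all add: inner_complex_def algebra_simps)
  with rel have "A * (Re (v * cnj d)) = A * (- B * \<tau>)"
    unfolding Rw by (simp add: A_def B_def algebra_simps)
  then have Rv: "Re (v * cnj d) = - B * \<tau>"
    using AB by (metis mult_left_cancel less_irrefl)
  have "(Re (z * cnj d))\<^sup>2 + (Im (z * cnj d))\<^sup>2 = (norm z)\<^sup>2 * N" for z
    by (metis N_def cmod_power2 complex_mod_cnj norm_mult power_mult_distrib)
  from this[of w] this[of v] have x2: "x\<^sup>2 = A\<^sup>2 * (N - \<tau>\<^sup>2)" and y2: "y\<^sup>2 = B\<^sup>2 * (N - \<tau>\<^sup>2)"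
    unfolding Rw Rv by (simp_all add: x_def y_def A_def B_def algebra_simps)
  have inner: "(w \<bullet> v) * N = - A * B * \<tau>\<^sup>2 + x * y"
  proof -
    have "(w \<bullet> v) * N = Re (w * cnj d) * Re (v * cnj d) + Im (w * cnj d) * Im (v * cnj d)"
      unfolding N_def cmod_power2 by (simp add: inner_complex_def algebra_simps power2_eq_square)
    then show ?thesis
      unfolding Rw Rv x_def y_def by (simp add: power2_eq_square)
  qed
  have "(dist f g)\<^sup>2 = A\<^sup>2 + B\<^sup>2 - 2 * (w \<bullet> v)"
    unfolding wv A_def B_def power2_norm_eq_inner
    by (simp add: inner_diff_left inner_diff_right inner_commute)
  then have k: "(r\<^sup>2 - (dist f g)\<^sup>2) * N = 2 * (A * B * (N - \<tau>\<^sup>2)) + 2 * (x * y)"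
    using inner unfolding wv(1)[symmetric] A_def[symmetric] B_def[symmetric] by algebra
  \<comment> \<open>The minus sign would put the foci on opposite sides of the line and give dist f g = r.\<close>
  have "(x * y)\<^sup>2 = (A * B * (N - \<tau>\<^sup>2))\<^sup>2"
    using x2 y2 by algebra
  then have cases: "x * y = A * B * (N - \<tau>\<^sup>2) \<or> x * y = - (A * B * (N - \<tau>\<^sup>2))"
    by (simp add: power2_eq_iff)
  have "(r\<^sup>2 - (dist f g)\<^sup>2) * N > 0"
    using r AB by (simp add: power2_strict_mono)
  with k cases have "x * y = A * B * (N - \<tau>\<^sup>2)"
    by auto
  with k have "4 * x * y = (r\<^sup>2 - (dist f g)\<^sup>2) * N"
    by simp
  then show ?thesis
    unfolding x_def y_def N_def w_def v_def .
qed

text \<open>Each factor on the left has modulus twice the distance of a focus from the chord. The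
  relation \<open>d = - a * b * cnj d\<close> removes the direction of the tangent from the product
  formula, and the remaining real constant is the same for all chords.\<close>

lemma ellipse_tangent_chord:
  fixes a b f g :: complex
  assumes "norm a = 1" "norm b = 1" "a \<noteq> b" "dist f g < r"
    and "tangent_line (ellipse f g r) (line_through a b)"
  shows "(f + a * b * cnj f - a - b) * (g + a * b * cnj g - a - b) =
    of_real (r\<^sup>2 - (dist f g)\<^sup>2) * (a * b)"
proof -
  obtain \<gamma> t d where E: "range \<gamma> \<subseteq> ellipse f g r" "d \<noteq> 0"
      and \<gamma>: "(\<gamma> has_vector_derivative d) (at t)" and "line_through a b = range (\<lambda>s. \<gamma> t + s *\<^sub>R d)"
    using assms(5) unfolding tangent_line_def by blast
  then have pd: "\<gamma> t + a * b * cnj (\<gamma> t) = a + b" "d + a * b * cnj d = 0"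
    using line_through_unit_circle_eq_range[OF assms(1-3) E(2)] by auto
  have two_Im: "of_real (2 * Im z) * \<i> = z - cnj z" for z
    by (simp add: complex_eq_iff)
  define w v where "w = \<gamma> t - f" and "v = \<gamma> t - g"
  have "complex_of_real (4 * Im (w * cnj d) * Im (v * cnj d)) =
      - ((of_real (2 * Im (w * cnj d)) * \<i>) * (of_real (2 * Im (v * cnj d)) * \<i>))"
    by (simp add: complex_eq_iff algebra_simps)
  also have "\<dots> = - ((w * cnj d - cnj w * d) * (v * cnj d - cnj v * d))"
    unfolding two_Im by simp
  finally have *: "- ((w * cnj d - cnj w * d) * (v * cnj d - cnj v * d)) =
      of_real (r\<^sup>2 - (dist f g)\<^sup>2) * (d * cnj d)"
    using ellipse_tangent_product[OF assms(4) E(1) \<gamma> E(2)]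
    unfolding complex_norm_square[symmetric] w_def v_def by (metis of_real_mult)
  have "w * cnj d - cnj w * d = - (f + a * b * cnj f - a - b) * cnj d"
    "v * cnj d - cnj v * d = - (g + a * b * cnj g - a - b) * cnj d"
    using pd unfolding w_def v_def complex_cnj_diff by algebra+
  then have "cnj d * cnj d * ((f + a * b * cnj f - a - b) * (g + a * b * cnj g - a - b)) =
      cnj d * cnj d * (of_real (r\<^sup>2 - (dist f g)\<^sup>2) * (a * b))"
    using * pd(2) by algebra
  then show ?thesis
    using E(2) by simp
qed

text \<open>The constant \<open>k\<close> is common to the three sides and can be eliminated. The
  conjugates of \<open>f\<close> and \<open>g\<close> enter as independent elements
  \<open>f'\<close> and \<open>g'\<close>, since the elimination is purely polynomial.\<close>

lemma isogonal_sum: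
  fixes a b c f g f' g' k :: "'a::field"
  assumes "a \<noteq> b" "b \<noteq> c" "c \<noteq> a"
    and ab: "(f + a * b * f' - a - b) * (g + a * b * g' - a - b) = k * (a * b)"
    and bc: "(f + b * c * f' - b - c) * (g + b * c * g' - b - c) = k * (b * c)"
    and ca: "(f + c * a * f' - c - a) * (g + c * a * g' - c - a) = k * (c * a)"
  shows "a + b + c = f + g + a * b * c * (f' * g')"
proof -
  \<comment> \<open>Twice, the difference of two hypotheses is divided by a difference of two vertices.\<close>
  define Q where "Q x y = x * (f * g' + f' * g) + x\<^sup>2 * y * (f' * g') - (f + g)
    - x * (a + b + c) * (f' + g') + (y + 2 * x) - k * x" for x y
  have "(a - c) * Q b (a + c) = 0" "(b - c) * Q a (b + c) = 0"
    using ab bc ca unfolding Q_def by algebra+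
  then have Q: "Q b (a + c) = 0" "Q a (b + c) = 0"
    using assms by auto
  \<comment> \<open>In \<open>a * Q b (a + c) - b * Q a (b + c)\<close> the terms linear in
    \<open>x\<close> whose coefficient is symmetric in the vertices cancel, among them the only one
    with \<open>k\<close>, and \<open>b - a\<close> factors out.\<close>
  then have "(b - a) * (a + b + c - (f + g + a * b * c * (f' * g'))) = 0"
    unfolding Q_def by algebra
  then show ?thesis
    using assms by auto
qed


section \<open>Parabolas whose directrix passes through the origin\<close>

text \<open>Multiplication by \<open>cnj u\<close> rotates the line onto the real axis.\<close>

lemma infdist_real_line:
  fixes u z :: complex
  assumes "norm u = 1"
  shows "infdist z (range (\<lambda>t. of_real t * u)) = \<bar>Im (z * cnj u)\<bar>"
proof -
  have d: "dist z (of_real t * u) = norm (z * cnj u - of_real t)" for t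
  proof -
    have "u * cnj u = 1"
      using assms by (simp add: complex_norm_square[symmetric])
    then have "(z - of_real t * u) * cnj u = z * cnj u - of_real t"
      by algebra
    then show ?thesis
      using assms by (metis dist_norm complex_mod_cnj mult.right_neutral norm_mult)
  qed
  have "Inf (range (\<lambda>t. dist z (of_real t * u))) = \<bar>Im (z * cnj u)\<bar>"
  proof (rule cInf_eq_minimum)
    have "dist z (of_real (Re (z * cnj u)) * u) = \<bar>Im (z * cnj u)\<bar>"
      unfolding d cmod_def by simp
    then show "\<bar>Im (z * cnj u)\<bar> \<in> range (\<lambda>t. dist z (of_real t * u))"
      by (metis rangeI)
  next
    fix x assume "x \<in> range (\<lambda>t. dist z (of_real t * u))"
    then show "\<bar>Im (z * cnj u)\<bar> \<le> x"
      unfolding d using abs_Im_le_cmod by (smt (verit) Im_complex_of_real imageE minus_complex.sel(2))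
  qed
  then show ?thesis
    by (simp add: infdist_def image_image)
qed

lemma mem_real_line_iff:
  fixes u z :: complex
  assumes "norm u = 1"
  shows "z \<in> range (\<lambda>t. of_real t * u) \<longleftrightarrow> Im (z * cnj u) = 0"
proof
  have u: "u * cnj u = 1"
    using assms by (simp add: complex_norm_square[symmetric])
  then have "of_real t * u * cnj u = of_real t" for t
    by algebra
  then have *: "Im (of_real t * u * cnj u) = 0" for t
    by (simp only: Im_complex_of_real)
  show "Im (z * cnj u) = 0" if "z \<in> range (\<lambda>t. of_real t * u)"
    using that * by blast
  assume "Im (z * cnj u) = 0"
  then have "z * cnj u = of_real (Re (z * cnj u))"
    by (simp only: complex_eq_iff Re_complex_of_real Im_complex_of_real)
  moreover have "z = z * cnj u * u"
    using u by algebra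
  ultimately have "z = of_real (Re (z * cnj u)) * u"
    by (simp only:)
  then show "z \<in> range (\<lambda>t. of_real t * u)"
    by blast
qed

text \<open>\<open>a + b - a * b * cnj F\<close> is the reflection of \<open>F\<close> in the chord.
  It turns out to be the foot of the perpendicular from the point of contact to the
  directrix.\<close>

lemma parabola_tangent_reflection:
  fixes a b u F d :: complex and \<gamma> :: "real \<Rightarrow> complex"
  assumes u: "norm u = 1" and D: "D = range (\<lambda>t. of_real t * u)" and "F \<notin> D"
    and E: "range \<gamma> \<subseteq> parabola F D" and \<gamma>: "(\<gamma> has_vector_derivative d) (at t)" and "d \<noteq> 0"
    and p: "\<gamma> t + a * b * cnj (\<gamma> t) = a + b" and d: "d + a * b * cnj d = 0"
  shows "a + b - a * b * cnj F \<in> D"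
proof -
  \<comment> \<open>\<open>y\<close> is the signed height of the point of contact over
    \<open>D\<close>, and \<open>v\<close> is the vector to that point from its foot
    \<open>\<gamma> t - v\<close> on \<open>D\<close>.\<close>
  define w y where "w = \<gamma> t - F" and "y = Im (\<gamma> t * cnj u)"
  define v where "v = of_real y * (\<i> * u)"
  have uu: "u * cnj u = 1"
    using u by (simp add: complex_norm_square[symmetric])
  \<comment> \<open>Squaring removes the absolute value. Differentiation then shows that
    \<open>w\<close> and \<open>v\<close>, which have equal length, also have the same component
    along \<open>d\<close>.\<close>
  have sq: "(\<gamma> s - F) \<bullet> (\<gamma> s - F) = (Im (\<gamma> s * cnj u))\<^sup>2" for s
  proof -
    have "norm (\<gamma> s - F) = \<bar>Im (\<gamma> s * cnj u)\<bar>"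
      using E unfolding D parabola_def infdist_real_line[OF u] by (auto simp: dist_norm)
    then show ?thesis
      by (metis power2_abs power2_norm_eq_inner)
  qed
  have \<gamma>': "(\<gamma> has_derivative (\<lambda>h. h *\<^sub>R d)) (at t)"
    using \<gamma> by (simp add: has_vector_derivative_def)
  have "((\<lambda>s. (\<gamma> s - F) \<bullet> (\<gamma> s - F)) has_derivative (\<lambda>h. 2 * (w \<bullet> (h *\<^sub>R d)))) (at t)"
    unfolding w_def by (auto intro!: derivative_eq_intros \<gamma>' simp: inner_commute)
  moreover have "((\<lambda>s. (Im (\<gamma> s * cnj u))\<^sup>2) has_derivative (\<lambda>h. 2 * (y * Im (h *\<^sub>R d * cnj u)))) (at t)"
    unfolding y_def by (auto intro!: derivative_eq_intros \<gamma>' simp: algebra_simps)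
  ultimately have "(\<lambda>h. 2 * (w \<bullet> (h *\<^sub>R d))) = (\<lambda>h. 2 * (y * Im (h *\<^sub>R d * cnj u)))"
    unfolding sq by (rule has_derivative_unique)
  from fun_cong[OF this, of 1] have "w \<bullet> d = y * Im (d * cnj u)"
    by simp
  then have re: "Re (w * cnj d) = Re (v * cnj d)"
    by (simp add: v_def inner_complex_def algebra_simps)
  have "norm v = \<bar>y\<bar>"
    using u by (simp add: v_def norm_mult)
  moreover have "(norm w)\<^sup>2 = y\<^sup>2"
    unfolding power2_norm_eq_inner w_def y_def by (rule sq)
  ultimately have "(norm w)\<^sup>2 = (norm v)\<^sup>2"
    by simp
  then have "norm (w * cnj d) = norm (v * cnj d)"
    by (simp add: norm_mult)
  then have "(Im (w * cnj d))\<^sup>2 = (Im (v * cnj d))\<^sup>2"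
    using re by (metis add_left_cancel cmod_power2)
  \<comment> \<open>Either F is the foot of the perpendicular from the point of contact to D, or that foot is the
    reflection of F in the tangent.\<close>
  then have "w * cnj d = v * cnj d \<or> w * cnj d = cnj (v * cnj d)"
    using re by (auto simp: power2_eq_iff complex_eq_iff)
  moreover
  have foot: "\<gamma> t - v \<in> D"
  proof -
    have "Im (v * cnj u) = y"
      using uu unfolding v_def by (simp add: mult.assoc)
    then show ?thesis
      unfolding D mem_real_line_iff[OF u] by (simp add: left_diff_distrib y_def)
  qed
  have "w \<noteq> v"
    using foot \<open>F \<notin> D\<close> by (auto simp: w_def)
  ultimately have "w * cnj d = cnj v * d"
    using \<open>d \<noteq> 0\<close> by auto
  then have "cnj w * d = v * cnj d"
    by (metis complex_cnj_cnj complex_cnj_mult)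
  then have "cnj d * (a + b - a * b * cnj F - (\<gamma> t - v)) = 0"
    using p d unfolding w_def complex_cnj_diff by algebra
  then have "a + b - a * b * cnj F = \<gamma> t - v"
    using \<open>d \<noteq> 0\<close> by simp
  then show ?thesis
    using foot by simp
qed

text \<open>The point of contact is explicit: it is the point of the parabola on the perpendicular
  to \<open>D\<close> through the reflection of \<open>F\<close>. The tangent there is the
  perpendicular bisector of \<open>F\<close> and its reflection, which is the chord.\<close>

lemma reflection_parabola_tangent:
  fixes a b u F :: complex
  assumes ab: "norm a = 1" "norm b = 1" "a \<noteq> b"
    and u: "norm u = 1" and D: "D = range (\<lambda>t. of_real t * u)" and F: "F \<notin> D"
    and R: "a + b - a * b * cnj F \<in> D"
  shows "tangent_line (parabola F D) (line_through a b)"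
proof -
  have uu: "u * cnj u = 1" "a * cnj a = 1" "b * cnj b = 1"
    using u ab by (simp_all add: complex_norm_square[symmetric])
  obtain t where t: "a + b - a * b * cnj F = of_real t * u"
    using R D by blast
  \<comment> \<open>Coordinates of \<open>F\<close> along and across \<open>D\<close>, with the
    reflection of \<open>F\<close> as origin.\<close>
  define \<kappa> \<eta> where "\<kappa> = Re (F * cnj u) - t" and "\<eta> = Im (F * cnj u)"
  have \<eta>: "\<eta> \<noteq> 0"
    using F unfolding D mem_real_line_iff[OF u] by (simp add: \<eta>_def)
  have "F * cnj u = of_real t + of_real \<kappa> + \<i> * of_real \<eta>"
    by (simp add: \<kappa>_def \<eta>_def complex_eq_iff)
  then have F: "F = (of_real t + of_real \<kappa> + \<i> * of_real \<eta>) * u"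
    using uu(1) by algebra
  then have cF: "cnj F = (of_real t + of_real \<kappa> - \<i> * of_real \<eta>) * cnj u"
    by simp
  \<comment> \<open>\<open>Y s\<close> solves
    \<open>(s - \<kappa>)^2 + (Y s - \<eta>)^2 = (Y s)^2\<close>, so \<open>\<gamma>\<close> runs
    through the parabola according to the foot on \<open>D\<close>. Its velocity \<open>d\<close> at
    \<open>s = 0\<close> is \<open>- \<i> / \<eta>\<close> times the vector from the reflection to
    \<open>F\<close>.\<close>
  define Y where "Y s = ((s - \<kappa>)\<^sup>2 + \<eta>\<^sup>2) / (2 * \<eta>)" for s :: real
  define \<gamma> where "\<gamma> s = (of_real (t + s) + \<i> * of_real (Y s)) * u" for s :: real
  define d where "d = (1 - \<i> * of_real (\<kappa> / \<eta>)) * u"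
  have "u \<noteq> 0"
    using u by auto
  have "Re (1 - \<i> * of_real (\<kappa> / \<eta>)) = 1"
    by simp
  then have d0: "d \<noteq> 0"
    unfolding d_def using \<open>u \<noteq> 0\<close> by (metis mult_eq_0_iff zero_complex.simps(1) zero_neq_one)
  have par: "\<gamma> s \<in> parabola F D" for s
  proof -
    have "(\<gamma> s - F) * cnj u = Complex (s - \<kappa>) (Y s - \<eta>)"
    proof -
      have "(\<gamma> s - F) * cnj u = of_real (s - \<kappa>) + \<i> * of_real (Y s - \<eta>)"
        unfolding \<gamma>_def F using uu(1) by (simp, algebra)
      then show ?thesis
        by (simp add: complex_eq_iff)
    qed
    then have "norm (\<gamma> s - F) = norm (Complex (s - \<kappa>) (Y s - \<eta>))"
      using u by (metis complex_mod_cnj mult.right_neutral norm_mult)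
    moreover have "(s - \<kappa>)\<^sup>2 + (Y s - \<eta>)\<^sup>2 = (Y s)\<^sup>2"
      using \<eta> unfolding Y_def by (simp add: field_simps power2_eq_square)
    ultimately have "dist (\<gamma> s) F = \<bar>Y s\<bar>"
      by (simp add: dist_norm cmod_def)
    moreover have "\<gamma> s * cnj u = of_real (t + s) + \<i> * of_real (Y s)"
      unfolding \<gamma>_def using uu(1) by algebra
    then have "Im (\<gamma> s * cnj u) = Y s"
      by simp
    ultimately show ?thesis
      unfolding parabola_def D infdist_real_line[OF u] by simp
  qed
  have "(Y has_real_derivative - (\<kappa> / \<eta>)) (at 0)"
    unfolding Y_def using \<eta> by (auto intro!: derivative_eq_intros simp: field_simps)
  then have "((\<lambda>s. of_real (Y s) :: complex) has_vector_derivative of_real (- (\<kappa> / \<eta>))) (at 0)"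
    by (rule has_vector_derivative_of_real)
  moreover have "((\<lambda>s. of_real (t + s) :: complex) has_vector_derivative of_real 1) (at 0)"
    by (rule has_vector_derivative_of_real) (auto intro!: derivative_eq_intros)
  ultimately have "(\<gamma> has_vector_derivative (of_real 1 + \<i> * of_real (- (\<kappa> / \<eta>))) * u) (at 0)"
    unfolding \<gamma>_def
    by (intro has_vector_derivative_mult_left has_vector_derivative_add has_vector_derivative_mult_right)
  then have \<gamma>': "(\<gamma> has_vector_derivative d) (at 0)"
    by (simp add: d_def)
  have "cnj (a + b - a * b * cnj F) = cnj (of_real t * u)"
    by (simp only: t)
  then have "cnj a + cnj b - cnj a * cnj b * F = of_real t * cnj u"
    by simp
  moreover have "a * b * (cnj a + cnj b - cnj a * cnj b * F) =
      (a * cnj a) * b + a * (b * cnj b) - (a * cnj a) * (b * cnj b) * F"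
    by (simp add: algebra_simps)
  ultimately have "a + b - F = a * b * of_real t * cnj u"
    by (simp add: uu add.commute mult.assoc)
  \<comment> \<open>The vector from the reflection to \<open>F\<close> is perpendicular to the
    chord; \<open>d\<close>, a real multiple of it turned by a right angle, is therefore parallel to
    the chord.\<close>
  then have key: "(of_real \<kappa> + \<i> * of_real \<eta>) * u = a * b * cnj u * (of_real \<kappa> - \<i> * of_real \<eta>)"
    using t unfolding cF unfolding F by (simp add: algebra_simps)
  have \<eta>c: "complex_of_real \<eta> \<noteq> 0"
    using \<eta> by simp
  define e where "e = complex_of_real (\<kappa> / \<eta>)"
  have e: "of_real \<eta> * e = of_real \<kappa>"
    using \<eta>c by (simp add: e_def)
  have d: "d = (1 - \<i> * e) * u" "cnj d = (1 + \<i> * e) * cnj u"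
    by (simp_all add: d_def e_def)
  have "of_real \<eta> * (d + a * b * cnj d) =
      (of_real \<eta> * u + a * b * of_real \<eta> * cnj u) - \<i> * (of_real \<eta> * e) * (u - a * b * cnj u)"
    unfolding d(2) unfolding d(1) by (simp add: algebra_simps)
  also have "\<dots> = - \<i> * ((of_real \<kappa> + \<i> * of_real \<eta>) * u - a * b * cnj u * (of_real \<kappa> - \<i> * of_real \<eta>))"
    unfolding e by (simp add: algebra_simps)
  finally have "of_real \<eta> * (d + a * b * cnj d) = 0"
    unfolding key by simp
  then have dd: "d + a * b * cnj d = 0"
    using \<eta>c by simp
  have g0: "\<gamma> 0 = (of_real t + \<i> * of_real (Y 0)) * u" "cnj (\<gamma> 0) = (of_real t - \<i> * of_real (Y 0)) * cnj u"
    unfolding \<gamma>_def by simp_all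
  have "2 * \<eta> * Y 0 = \<kappa>\<^sup>2 + \<eta>\<^sup>2"
    unfolding Y_def using \<eta> by simp
  then have Y: "2 * of_real \<eta> * of_real (Y 0) = (of_real \<kappa>)\<^sup>2 + (of_real \<eta> :: complex)\<^sup>2"
    by (metis of_real_add of_real_mult of_real_numeral of_real_power)
  define k h y where "k = complex_of_real \<kappa>" and "h = complex_of_real \<eta>" and "y = complex_of_real (Y 0)"
  have Y': "2 * h * y = k\<^sup>2 + h\<^sup>2" and key': "(k + \<i> * h) * u = a * b * cnj u * (k - \<i> * h)"
    using Y key by (simp_all only: k_def h_def y_def)
  have dev: "\<gamma> 0 + a * b * cnj (\<gamma> 0) - (a + b) = \<i> * y * u - a * b * cnj u * (\<i> * y + (k - \<i> * h))"
    using t unfolding cF g0(2) unfolding g0(1) k_def[symmetric] h_def[symmetric] y_def[symmetric] by (simp add: algebra_simps)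
  \<comment> \<open>The factor \<open>k - \<i> * h\<close> allows \<open>key'\<close> to eliminate
    \<open>a * b * cnj u\<close>; what remains is the equation of the parabola at
    \<open>s = 0\<close>.\<close>
  have "(k - \<i> * h) * (\<gamma> 0 + a * b * cnj (\<gamma> 0) - (a + b)) =
      \<i> * y * u * (k - \<i> * h) - (k + \<i> * h) * u * (\<i> * y + (k - \<i> * h))"
    unfolding dev key' by (simp add: algebra_simps)
  also have "\<dots> = u * (2 * h * y - (k\<^sup>2 + h\<^sup>2))"
    by (simp add: algebra_simps power2_eq_square)
  also have "\<dots> = 0"
    using Y' by simp
  finally have "(k - \<i> * h) * (\<gamma> 0 + a * b * cnj (\<gamma> 0) - (a + b)) = 0" .
  moreover have "k - \<i> * h \<noteq> 0"
    using \<eta> by (simp add: k_def h_def complex_eq_iff)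
  ultimately have "\<gamma> 0 + a * b * cnj (\<gamma> 0) = a + b"
    by simp
  then have "line_through a b = range (\<lambda>s. \<gamma> 0 + s *\<^sub>R d)"
    using dd line_through_unit_circle_eq_range[OF ab d0] by blast
  then show ?thesis
    unfolding tangent_line_def using par \<gamma>' d0 by (metis image_subsetI)
qed

lemma tangent_parabola_iff:
  fixes a b u F :: complex
  assumes "norm a = 1" "norm b = 1" "a \<noteq> b"
    and "norm u = 1" "D = range (\<lambda>t. of_real t * u)" "F \<notin> D"
  shows "tangent_line (parabola F D) (line_through a b) \<longleftrightarrow> a + b - a * b * cnj F \<in> D"
proof
  assume "tangent_line (parabola F D) (line_through a b)"
  then obtain \<gamma> t d where E: "range \<gamma> \<subseteq> parabola F D" "d \<noteq> 0"
      and \<gamma>: "(\<gamma> has_vector_derivative d) (at t)" and "line_through a b = range (\<lambda>s. \<gamma> t + s *\<^sub>R d)"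
    unfolding tangent_line_def by blast
  then have "\<gamma> t + a * b * cnj (\<gamma> t) = a + b" "d + a * b * cnj d = 0"
    using line_through_unit_circle_eq_range[OF assms(1-3) E(2)] by auto
  then show "a + b - a * b * cnj F \<in> D"
    using parabola_tangent_reflection[OF assms(4-6) E(1) \<gamma> E(2)] by blast
qed (rule reflection_parabola_tangent[OF assms])


section \<open>Circumcenter and Euler line of an inscribed triangle\<close>

text \<open>The bisector passes through the center of the circle, so its equation is homogeneous. It
  serves both to locate the circumcenter and to characterize equilateral triangles.\<close>

lemma perpendicular_bisector_unit_circle:
  fixes a b x :: complex
  assumes "norm a = 1" "norm b = 1" "a \<noteq> b" "dist x a = dist x b"
  shows "x = a * b * cnj x"
proof -
  have ca: "a * cnj a = 1" "b * cnj b = 1"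
    using assms by (simp_all add: complex_norm_square[symmetric])
  have "complex_of_real ((dist x a)\<^sup>2) = of_real ((dist x b)\<^sup>2)"
    using assms(4) by simp
  then have "(x - a) * cnj (x - a) = (x - b) * cnj (x - b)"
    unfolding dist_norm complex_norm_square .
  then have "(b - a) * (x - a * b * cnj x) = 0"
    using ca unfolding complex_cnj_diff by algebra
  then show ?thesis
    using assms(3) by simp
qed

lemma circumcenter_unit_circle:
  assumes "norm a = 1" "norm b = 1" "norm c = 1" "a \<noteq> b" "b \<noteq> c" "c \<noteq> a"
  shows "circumcenter a b c = 0"
  unfolding circumcenter_def
proof (rule the_equality)
  show "dist 0 a = dist 0 b \<and> dist 0 b = dist 0 c"
    using assms by simp
next
  fix x assume "dist x a = dist x b \<and> dist x b = dist x c"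
  then have "x = a * b * cnj x" "x = b * c * cnj x"
    using perpendicular_bisector_unit_circle assms by blast+
  then have "(c - a) * (b * cnj x) = 0"
    by algebra
  then show "x = 0"
    using assms by auto
qed

lemma equilateral_unit_circle_iff:
  assumes "norm a = 1" "norm b = 1" "norm c = 1" "a \<noteq> b" "b \<noteq> c" "c \<noteq> a"
  shows "equilateral a b c \<longleftrightarrow> a + b + c = 0"
proof
  assume "equilateral a b c"
  then have "dist b a = dist b c" "dist c a = dist c b"
    by (simp_all add: equilateral_def dist_commute)
  \<comment> \<open>Two vertices lie on the bisectors of their opposite sides, so
    \<open>b * b = a * c\<close> and \<open>c * c = a * b\<close>; the difference is divisible by
    \<open>b - c\<close>.\<close>
  then have "b = a * c * cnj b" "c = a * b * cnj c"
    using perpendicular_bisector_unit_circle assms by metis+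
  moreover have "b * cnj b = 1" "c * cnj c = 1"
    using assms by (simp_all add: complex_norm_square[symmetric])
  ultimately have "b * b = a * c" "c * c = a * b"
    by algebra+
  then have "(b - c) * (a + b + c) = 0"
    by algebra
  then show "a + b + c = 0"
    using assms by simp
next
  assume sum: "a + b + c = 0"
  \<comment> \<open>By the parallelogram law every side has length \<open>sqrt 3\<close>.\<close>
  have "(dist x y)\<^sup>2 = 3" if "norm x = 1" "norm y = 1" "norm z = 1" "x + y = - z" for x y z :: complex
  proof -
    have "(norm (x - y))\<^sup>2 = 2 * (norm x)\<^sup>2 + 2 * (norm y)\<^sup>2 - (norm (x + y))\<^sup>2"
      unfolding power2_norm_eq_inner by (simp add: algebra_simps inner_commute)
    then show ?thesis
      using that by (simp add: dist_norm)
  qed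
  moreover have "a + b = - c" "b + c = - a" "c + a = - b"
    using sum by (simp_all add: eq_neg_iff_add_eq_0 ac_simps)
  ultimately have "(dist a b)\<^sup>2 = 3" "(dist b c)\<^sup>2 = 3" "(dist c a)\<^sup>2 = 3"
    using assms(1-3) by blast+
  then show "equilateral a b c"
    unfolding equilateral_def by (metis power2_eq_imp_eq zero_le_dist)
qed

text \<open>With circumcenter 0 the line consists of the real multiples of \<open>a + b + c\<close>;
  \<open>sgn\<close> supplies the unit vector that the results on parabolas require.\<close>

lemma euler_line_unit_circle:
  fixes a b c :: complex
  assumes "norm a = 1" "norm b = 1" "norm c = 1" "a \<noteq> b" "b \<noteq> c" "c \<noteq> a"
    and h: "a + b + c \<noteq> 0"
  shows "euler_line a b c = range (\<lambda>t. of_real t * sgn (a + b + c))"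
proof -
  define h where "h = a + b + c"
  have e: "euler_line a b c = range (\<lambda>s. s *\<^sub>R (h / 3))"
    unfolding euler_line_def line_through_def barycenter_def circumcenter_unit_circle[OF assms(1-6)]
      insert_commute[of _ 0] affine_hull_2_alt h_def by simp
  have "s *\<^sub>R (h / 3) = of_real (s * norm h / 3) * sgn h"
    "of_real t * sgn h = (3 * t / norm h) *\<^sub>R (h / 3)" for s t
    using h by (simp_all add: h_def sgn_div_norm scaleR_conv_of_real field_simps)
  then show ?thesis
    unfolding e h_def[symmetric] by (metis (no_types, lifting) image_subset_iff rangeI subset_antisym)
qed

lemma mem_line_sgn_iff:
  fixes h z :: complex
  assumes "h \<noteq> 0"
  shows "z \<in> range (\<lambda>t. of_real t * sgn h) \<longleftrightarrow> z * cnj h = cnj z * h"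
proof -
  have "Im (z * cnj (sgn h)) = Im (z * cnj h) / norm h"
    by (simp add: sgn_div_norm scaleR_conv_of_real field_simps)
  moreover have "z * cnj h = cnj z * h \<longleftrightarrow> Im (z * cnj h) = 0"
    by (auto simp: complex_eq_iff)
  ultimately show ?thesis
    using assms mem_real_line_iff[of "sgn h" z] by (simp add: norm_sgn)
qed

section \<open>The focus of the Kiepert parabola\<close>

text \<open>This form isolates the dependence on the side: apart from the factor \<open>c^2\<close>
  everything is symmetric in the vertices, so the conditions for the three sides can be
  compared.\<close>

lemma reflection_mem_line_iff:
  fixes a b c F h e :: complex
  assumes "norm a = 1" "norm b = 1" "norm c = 1"
    and h: "h = a + b + c" "h \<noteq> 0" and e: "e = a * b + b * c + c * a"
  shows "a + b - a * b * cnj F \<in> range (\<lambda>t. of_real t * sgn h) \<longleftrightarrow>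
    c\<^sup>2 * (F * h - e) = a * b * c * (e * cnj F - h)"
proof -
  have ca: "a * cnj a = 1" "b * cnj b = 1" "c * cnj c = 1" and ne: "a \<noteq> 0" "b \<noteq> 0" "c \<noteq> 0"
    using assms by (auto simp: complex_norm_square[symmetric])
  define q where "q = a + b - a * b * cnj F"
  have hh: "a * b * c * cnj h = e"
    using ca unfolding h e by (simp, algebra)
  have "a * b * cnj q = (a * cnj a) * b + a * (b * cnj b) - (a * cnj a) * (b * cnj b) * F"
    unfolding q_def by (simp add: algebra_simps)
  then have qq: "a * b * cnj q = a + b - F"
    unfolding ca by simp
  \<comment> \<open>The factor \<open>a * b * c * c\<close> makes \<open>hh\<close> and
    \<open>qq\<close> applicable, which replace the conjugates of \<open>h\<close> and
    \<open>q\<close>.\<close>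
  have "q * cnj h = cnj q * h \<longleftrightarrow> (a * b * c * c) * (q * cnj h) = (a * b * c * c) * (cnj q * h)"
    using ne by simp
  also have "\<dots> \<longleftrightarrow> c * (q * (a * b * c * cnj h)) - c\<^sup>2 * ((a * b * cnj q) * h) = 0"
    by (simp add: power2_eq_square algebra_simps)
  also have "c * (q * (a * b * c * cnj h)) - c\<^sup>2 * ((a * b * cnj q) * h) =
      c\<^sup>2 * (F * h - e) - a * b * c * (e * cnj F - h)"
    unfolding hh qq unfolding q_def h(1) e by (simp add: algebra_simps power2_eq_square)
  finally show ?thesis
    unfolding mem_line_sgn_iff[OF h(2)] q_def by simp
qed

text \<open>Since \<open>e - h * c = a * b - c^2\<close>, the condition says that the triangle is
  isosceles with apex \<open>c\<close>, and also that the point \<open>e / h\<close> is this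
  apex.\<close>

lemma perpendicular_chord_iff:
  fixes a b c h e :: complex
  assumes "norm a = 1" "norm b = 1" "norm c = 1" "a \<noteq> b"
    and h: "h = a + b + c" "h \<noteq> 0" and e: "e = a * b + b * c + c * a"
  shows "perpendicular (line_through a b) (range (\<lambda>t. of_real t * sgn h)) \<longleftrightarrow> e = h * c"
proof -
  have ca: "a * cnj a = 1" "b * cnj b = 1" "c * cnj c = 1" and ne: "a \<noteq> 0" "b \<noteq> 0" "c \<noteq> 0"
    using assms by (auto simp: complex_norm_square[symmetric])
  have hh: "a * b * c * cnj h = e"
    using ca unfolding h e by (simp, algebra)
  have "orthogonal (b - a) h \<longleftrightarrow> Re ((b - a) * cnj h) = 0"
    by (simp add: orthogonal_def inner_complex_def algebra_simps)
  also have "\<dots> \<longleftrightarrow> (b - a) * cnj h + cnj (b - a) * h = 0"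
    by (auto simp: complex_eq_iff algebra_simps)
  also have "\<dots> \<longleftrightarrow> a * b * c * ((b - a) * cnj h + cnj (b - a) * h) = 0"
    using ne by simp
  also have "a * b * c * ((b - a) * cnj h + cnj (b - a) * h) =
      (b - a) * (a * b * c * cnj h) + ((b * cnj b) * a - (a * cnj a) * b) * c * h"
    by (simp add: algebra_simps)
  also have "\<dots> = (b - a) * (e - h * c)"
    unfolding ca hh by (simp add: algebra_simps)
  finally have orth: "orthogonal (b - a) h \<longleftrightarrow> e = h * c"
    using assms(4) by simp
  have "perpendicular (line_through a b) (range (\<lambda>t. of_real t * sgn h)) \<longleftrightarrow> orthogonal (b - a) h"
  proof
    assume p: "perpendicular (line_through a b) (range (\<lambda>t. of_real t * sgn h))"
    have "h \<in> range (\<lambda>t. of_real t * sgn h)" "0 \<in> range (\<lambda>t. of_real t * sgn h)"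
      unfolding mem_line_sgn_iff[OF h(2)] by simp_all
    moreover have "a \<in> line_through a b" "b \<in> line_through a b"
      by (simp_all add: line_through_def hull_inc)
    ultimately have "orthogonal (b - a) (h - 0)"
      using p unfolding perpendicular_def by blast
    then show "orthogonal (b - a) h"
      by simp
  next
    assume o: "orthogonal (b - a) h"
    have "orthogonal (x - y) (u - v)" if xy: "x \<in> line_through a b" "y \<in> line_through a b"
      and uv: "u \<in> range (\<lambda>t. of_real t * sgn h)" "v \<in> range (\<lambda>t. of_real t * sgn h)" for x y u v
    proof -
      obtain s s' where "x = a + s *\<^sub>R (b - a)" "y = a + s' *\<^sub>R (b - a)"
        using xy unfolding line_through_def affine_hull_2_alt by blast
      then have x: "x - y = (s - s') *\<^sub>R (b - a)"
        by (simp add: scaleR_left_diff_distrib)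
      obtain t t' where "u = of_real t * sgn h" "v = of_real t' * sgn h"
        using uv by blast
      then have u: "u - v = ((t - t') / norm h) *\<^sub>R h"
        by (simp add: sgn_div_norm scaleR_conv_of_real divide_inverse algebra_simps)
      show ?thesis
        unfolding x u by (intro orthogonal_clauses o)
    qed
    then show "perpendicular (line_through a b) (range (\<lambda>t. of_real t * sgn h))"
      unfolding perpendicular_def by blast
  qed
  with orth show ?thesis by simp
qed

lemma mem_two_chords:
  fixes a b c F :: complex
  assumes "norm a = 1" "norm b = 1" "norm c = 1" "a \<noteq> b" "b \<noteq> c" "c \<noteq> a"
    and "F \<in> line_through b c" "F \<in> line_through c a"
  shows "F = c"
proof -
  have F: "F + b * c * cnj F = b + c" "F + c * a * cnj F = c + a"
    using assms(7,8) by (simp_all add: line_through_unit_circle assms)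
  then have "(b - a) * (c * cnj F - 1) = 0"
    by algebra
  then have "c * cnj F = 1"
    using assms(4) by simp
  with F(1) show ?thesis
    by algebra
qed

text \<open>One linear equation covers both alternatives of \<open>is_X110\<close>: the proper
  parabola and, for isosceles triangles, the degenerate one with the apex as focus. Existence and
  uniqueness of the focus follow.\<close>

lemma is_X110_unit_circle:
  fixes a b c F :: complex
  assumes abc: "norm a = 1" "norm b = 1" "norm c = 1" "a \<noteq> b" "b \<noteq> c" "c \<noteq> a"
    and h0: "a + b + c \<noteq> 0"
  shows "is_X110 a b c F \<longleftrightarrow> (a + b + c) * F = a * b + b * c + c * a"
proof -
  define h e p where "h = a + b + c" and "e = a * b + b * c + c * a" and "p = a * b * c"
  define D where "D = range (\<lambda>t. of_real t * sgn h)"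
  have h: "h = a + b + c" "h = b + c + a" "h = c + a + b" "h \<noteq> 0"
    and e: "e = a * b + b * c + c * a" "e = b * c + c * a + a * b" "e = c * a + a * b + b * c"
    and p: "p = a * b * c" "p = b * c * a" "p = c * a * b"
    using h0 by (simp_all add: h_def e_def p_def)
  have u: "norm (sgn h) = 1"
    using h by (simp add: norm_sgn)
  have D: "euler_line a b c = D"
    using euler_line_unit_circle[OF abc h0] by (simp add: D_def h_def)
  have ca: "a * cnj a = 1" "b * cnj b = 1" "c * cnj c = 1" and ne: "a \<noteq> 0" "b \<noteq> 0" "c \<noteq> 0"
    using abc by (auto simp: complex_norm_square[symmetric])
  note tan = tangent_parabola_iff[OF _ _ _ u D_def]
  note refl = reflection_mem_line_iff[OF _ _ _ _ h(4), folded D_def]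
  have kiepert: "kiepert_parabola_focus a b c F \<longleftrightarrow> F \<notin> D \<and>
      c\<^sup>2 * (F * h - e) = p * (e * cnj F - h) \<and> a\<^sup>2 * (F * h - e) = p * (e * cnj F - h) \<and>
      b\<^sup>2 * (F * h - e) = p * (e * cnj F - h)"
    unfolding kiepert_parabola_focus_def D side_lines_def
    using tan[OF abc(1,2,4), of F] tan[OF abc(2,3,5), of F] tan[OF abc(3,1,6), of F]
      refl[OF abc(1,2,3) h(1) e(1), of F] refl[OF abc(2,3,1) h(2) e(2), of F]
      refl[OF abc(3,1,2) h(3) e(3), of F] p by auto
  note perp = perpendicular_chord_iff[OF _ _ _ _ _ h(4), folded D_def]
  have degenerate: "degenerate_kiepert_focus a b c F \<longleftrightarrow> F \<in> D \<and>
      (F \<in> line_through a b \<or> e = h * c) \<and> (F \<in> line_through b c \<or> e = h * a) \<and>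
      (F \<in> line_through c a \<or> e = h * b)"
    unfolding degenerate_kiepert_focus_def D side_lines_def
    using perp[OF abc(1,2,3,4) h(1) e(1)] perp[OF abc(2,3,1,5) h(2) e(2)]
      perp[OF abc(3,1,2,6) h(3) e(3)] by auto
  have vertex: "F = c" if "F \<in> line_through b c" "F \<in> line_through c a"
    using mem_two_chords[OF abc that] .
  have vertex': "F = a" if "F \<in> line_through c a" "F \<in> line_through a b"
    using mem_two_chords[OF abc(2,3,1,5,6,4) that] .
  have vertex'': "F = b" if "F \<in> line_through a b" "F \<in> line_through b c"
    using mem_two_chords[OF abc(3,1,2,6,4,5) that] .
  have ph: "p * cnj h = e" "p * cnj e = h"
    using ca unfolding h(1) e(1) p(1) by (simp, algebra)+
  have "is_X110 a b c F \<longleftrightarrow> h * F = e"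
  proof
    assume "is_X110 a b c F"
    then consider "kiepert_parabola_focus a b c F" | "degenerate_kiepert_focus a b c F"
      unfolding is_X110_def by blast
    then show "h * F = e"
    proof cases
      case 1
      then have "a\<^sup>2 * (F * h - e) = b\<^sup>2 * (F * h - e)" "b\<^sup>2 * (F * h - e) = c\<^sup>2 * (F * h - e)"
        unfolding kiepert by simp_all
      \<comment> \<open>Three distinct numbers cannot all agree up to sign, so
        \<open>F * h - e\<close> must vanish.\<close>
      then have "a\<^sup>2 = b\<^sup>2 \<and> b\<^sup>2 = c\<^sup>2" if "F * h - e \<noteq> 0"
        using that by simp
      then show ?thesis
        using abc(4-6) by (simp add: power2_eq_iff mult.commute[of h]) (metis add.inverse_inverse)
    next
      case 2
      \<comment> \<open>\<open>e = h * x\<close> holds for at most one vertex \<open>x\<close>, so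
        at least two side lines pass through \<open>F\<close>. Then \<open>F\<close> is their common
        vertex, and the third side line must be the perpendicular one, which gives
        \<open>h * F = e\<close>.\<close>
      have "h * x \<noteq> h * y" if "x \<noteq> y" for x y
        using that h(4) by simp
      then show ?thesis
        using 2 vertex vertex' vertex'' abc(4-6) unfolding degenerate by metis
    qed
  next
    assume F: "h * F = e"
    then have "cnj h * cnj F = cnj e"
      by (metis complex_cnj_mult)
    then have G: "e * cnj F = h"
      using ph by (metis mult.assoc)
    show "is_X110 a b c F"
    proof (cases "F \<in> D")
      case False
      then show ?thesis
        unfolding is_X110_def kiepert using F G by (simp add: mult.commute)
    next
      \<comment> \<open>On the Euler line \<open>F^3 = p\<close>, and with \<open>h * F = e\<close>
        this makes \<open>F\<close> a root of the cubic with roots \<open>a\<close>,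
        \<open>b\<close>, \<open>c\<close>. Two side lines pass through this vertex, and the third
        is perpendicular to the Euler line.\<close>
      case True
      then have "F * cnj h = cnj F * h"
        unfolding D_def mem_line_sgn_iff[OF h(4)] .
      then have "F * (p * cnj h) = p * cnj F * h"
        by (simp add: mult.left_commute)
      then have "F * e = p * cnj F * h"
        by (simp only: ph)
      then have "h\<^sup>2 * (F ^ 3 - p) = 0"
        using F G by algebra
      then have "F ^ 3 = p"
        using h(4) by simp
      then have "(F - a) * (F - b) * (F - c) = 0"
        using F unfolding h(1) e(1) p(1) by algebra
      then have "F = a \<or> F = b \<or> F = c"
        by auto
      moreover have "x \<in> line_through x y" "y \<in> line_through x y" for x y
        by (simp_all add: line_through_def hull_inc)
      ultimately show ?thesis
        unfolding is_X110_def degenerate using True F by metis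
    qed
  qed
  then show ?thesis
    unfolding h_def e_def .
qed

section \<open>Foci, symmetric functions of the vertices, and the Poncelet family\<close>

text \<open>A focus lies on the major axis between its endpoints, which belong to the ellipse, and
  the ball is convex.\<close>

lemma focus_in_ball:
  fixes f g :: complex
  assumes "dist f g < r" and "ellipse f g r \<subseteq> ball 0 1"
  shows "norm f < 1"
proof -
  define \<delta> s where "\<delta> = dist f g" and "s = (r - \<delta>) / 2"
  obtain u where u: "norm u = 1" "g - f = \<delta> *\<^sub>R u"
  proof (cases "f = g")
    case True
    \<comment> \<open>For a circle any diameter serves as major axis.\<close>
    then show ?thesis
      using that[of 1] by (simp add: \<delta>_def)
  next
    case False
    then show ?thesis
      using that[of "sgn (g - f)"] by (simp add: norm_sgn \<delta>_def sgn_div_norm dist_norm norm_minus_commute)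
  qed
  have s: "s > 0" "\<delta> \<ge> 0" "r = 2 * s + \<delta>"
    using assms(1) by (simp_all add: s_def \<delta>_def field_simps)
  have g: "g = f + \<delta> *\<^sub>R u"
    using u(2) by (simp add: algebra_simps)
  have "f - s *\<^sub>R u - g = (- (s + \<delta>)) *\<^sub>R u" "f + (s + \<delta>) *\<^sub>R u - g = s *\<^sub>R u"
    unfolding g by (simp_all add: algebra_simps)
  then have "f - s *\<^sub>R u \<in> ellipse f g r" "f + (s + \<delta>) *\<^sub>R u \<in> ellipse f g r"
    using s u(1) unfolding ellipse_def mem_Collect_eq dist_norm by simp_all
  then have in_ball: "f - s *\<^sub>R u \<in> ball 0 1" "f + (s + \<delta>) *\<^sub>R u \<in> ball 0 1"
    using assms(2) by blast+
  \<comment> \<open>The endpoints lie at distances \<open>s\<close> and \<open>s + \<delta>\<close>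
    on opposite sides of \<open>f\<close>; this weight makes their convex combination equal to
    \<open>f\<close>.\<close>
  define \<tau> where "\<tau> = s / r"
  have \<tau>: "0 \<le> \<tau>" "\<tau> \<le> 1" "r * \<tau> = s"
    using s by (simp_all add: \<tau>_def field_simps)
  have "(1 - \<tau>) *\<^sub>R (f - s *\<^sub>R u) + \<tau> *\<^sub>R (f + (s + \<delta>) *\<^sub>R u) \<in> ball 0 1"
    using convexD_alt[OF convex_ball in_ball \<tau>(1,2)] .
  also have "(1 - \<tau>) *\<^sub>R (f - s *\<^sub>R u) + \<tau> *\<^sub>R (f + (s + \<delta>) *\<^sub>R u) = f + (r * \<tau> - s) *\<^sub>R u"
    by (simp add: s(3) scaleR_conv_of_real algebra_simps)
  finally show ?thesis
    by (simp add: \<tau>(3))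
qed

lemma poncelet_triangle_unit_circle:
  assumes "poncelet_triangle E a b c"
  shows "norm a = 1" "norm b = 1" "norm c = 1" "a \<noteq> b" "b \<noteq> c" "c \<noteq> a"
  using assms unfolding poncelet_triangle_def triangle_def
  by (auto simp: insert_commute)

lemma poncelet_triangle_sums:
  fixes f g :: complex
  assumes "dist f g < r" and T: "poncelet_triangle (ellipse f g r) a b c"
  shows "a + b + c = f + g + a * b * c * cnj (f * g)"
    and "a * b + b * c + c * a = f * g + a * b * c * cnj (f + g)"
proof -
  note abc = poncelet_triangle_unit_circle[OF T]
  have "tangent_line (ellipse f g r) (line_through a b)"
    "tangent_line (ellipse f g r) (line_through b c)"
    "tangent_line (ellipse f g r) (line_through c a)"
    using T by (simp_all add: poncelet_triangle_def side_lines_def)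
  with ellipse_tangent_chord[OF _ _ _ assms(1)] abc
  show s: "a + b + c = f + g + a * b * c * cnj (f * g)"
    unfolding complex_cnj_mult by (intro isogonal_sum[OF abc(4-6)]) blast+
  have ca: "a * cnj a = 1" "b * cnj b = 1" "c * cnj c = 1"
    using abc by (simp_all add: complex_norm_square[symmetric])
  have "cnj (a + b + c) = cnj (f + g + a * b * c * cnj (f * g))"
    by (simp only: s)
  then show "a * b + b * c + c * a = f * g + a * b * c * cnj (f + g)"
    using ca by (simp, algebra)
qed

theorem proposition1:
  fixes f g :: complex and r :: real
  assumes "f \<noteq> 0" and "g \<noteq> 0"
    and "dist f g < r"
    and "ellipse f g r \<subseteq> ball 0 1"
    and "poncelet_family (ellipse f g r)"
  shows "(1 / f + 1 / g \<in> sphere 0 1 \<longleftrightarrow>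
            (\<exists>a b c. poncelet_triangle (ellipse f g r) a b c \<and> equilateral a b c)) \<and>
         (1 / f + 1 / g \<in> sphere 0 1 \<longrightarrow>
            (\<forall>a b c. poncelet_triangle (ellipse f g r) a b c \<and> \<not> equilateral a b c \<longrightarrow>
               (\<forall>F. is_X110 a b c F \<longleftrightarrow> F = inverse (1 / f + 1 / g))))"
proof -
  define \<sigma> m where "\<sigma> = f + g" and "m = f * g"
  have m0: "m \<noteq> 0"
    using assms by (simp add: m_def)
  have quot: "1 / f + 1 / g = \<sigma> / m"
    using assms by (simp add: \<sigma>_def m_def field_simps)
  then have sphere: "1 / f + 1 / g \<in> sphere 0 1 \<longleftrightarrow> norm \<sigma> = norm m"
    using m0 by (auto simp: norm_divide)
  note sums = poncelet_triangle_sums[OF assms(3), folded \<sigma>_def m_def]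
  note equil = equilateral_unit_circle_iff[OF poncelet_triangle_unit_circle]
  have "\<exists>a b c. poncelet_triangle (ellipse f g r) a b c \<and> equilateral a b c" if "norm \<sigma> = norm m"
  proof -
    \<comment> \<open>The value that \<open>a * b * c\<close> must take for
      \<open>\<sigma> + a * b * c * cnj m\<close>, the sum of the vertices, to vanish.\<close>
    define l where "l = - \<sigma> / cnj m"
    have l: "norm l = 1" "l * cnj m = - \<sigma>"
      using m0 that by (simp_all add: l_def norm_divide)
    have "cnj l * m = - cnj \<sigma>"
      using arg_cong[OF l(2), of cnj] by simp
    moreover have "l * cnj l = 1"
      using l(1) by (simp add: complex_norm_square[symmetric])
    \<comment> \<open>Hence, with \<open>p = a * b * c\<close>, the symmetric functions
      \<open>h\<close> and \<open>e\<close> of any triangle of the family are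
      \<open>(p - l) * cnj m\<close> and \<open>(p - l) * cnj \<sigma>\<close>.\<close>
    ultimately have m: "m = - l * cnj \<sigma>"
      by algebra
    \<comment> \<open>An equilateral triangle on the unit circle consists of the cube roots of p, and h = 0 forces
      p = l; so the triangle of the family with a cube root of l as a vertex is the one sought.\<close>
    define a where "a = cis (Arg l / 3)"
    have "a ^ 3 = cis (Arg l)"
      unfolding a_def Complex.DeMoivre by simp
    also have "\<dots> = l"
      using l(1) by (metis cis_Arg div_by_1 norm_zero of_real_1 sgn_eq zero_neq_one)
    finally have a3: "a ^ 3 = l" .
    have "norm a = 1"
      by (simp add: a_def)
    then have "a \<in> sphere 0 1"
      by simp
    then obtain b c where T: "poncelet_triangle (ellipse f g r) a b c"
      using assms(5) unfolding poncelet_family_def by blast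
    \<comment> \<open>With the foci inside the disk, \<open>1 - cnj f * a\<close> and
      \<open>1 - cnj g * a\<close> do not vanish on the circle. Their product is the cofactor of
      \<open>a * b * c - l\<close> in the cubic evaluated at \<open>a\<close>.\<close>
    have ne: "1 - cnj z * a \<noteq> 0" if "norm z < 1" for z
      using that \<open>norm a = 1\<close> by (metis complex_mod_cnj eq_iff_diff_eq_0 less_irrefl mult.right_neutral norm_mult norm_one)
    have "norm f < 1"
      using focus_in_ball[OF assms(3,4)] .
    moreover have "norm g < 1"
      using focus_in_ball[of g f r] assms(3,4) by (simp add: ellipse_def dist_commute add.commute)
    ultimately have "(1 - cnj f * a) * (1 - cnj g * a) \<noteq> 0"
      using ne by simp
    then have "1 - cnj \<sigma> * a + cnj m * a\<^sup>2 \<noteq> 0"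
      by (simp add: \<sigma>_def m_def algebra_simps power2_eq_square)
    moreover have "a ^ 3 - (a + b + c) * a\<^sup>2 + (a * b + b * c + c * a) * a - a * b * c = 0"
      by algebra
    \<comment> \<open>Inserting the sums into the vertex cubic at \<open>a\<close> leaves
      \<open>a^3 - l\<close>, which is 0, minus this product.\<close>
    then have "(a * b * c - l) * (1 - cnj \<sigma> * a + cnj m * a\<^sup>2) = 0"
      using sums[OF T] a3 l(2) m by algebra
    ultimately have "a * b * c = l"
      by simp
    then have "a + b + c = 0"
      using sums(1)[OF T] l(2) by simp
    then show ?thesis
      using T equil[OF T T T T T T] by blast
  qed
  moreover have "norm \<sigma> = norm m" if T: "poncelet_triangle (ellipse f g r) a b c" and "equilateral a b c" for a b c
  proof -
    have "a + b + c = 0"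
      using that equil[OF T T T T T T] by blast
    then have "\<sigma> = - (a * b * c * cnj m)"
      using sums(1)[OF T] by (simp add: eq_neg_iff_add_eq_0)
    then show ?thesis
      using poncelet_triangle_unit_circle(1-3)[OF T] by (simp add: norm_mult)
  qed
  moreover have "is_X110 a b c F \<longleftrightarrow> F = inverse (1 / f + 1 / g)"
    if \<sigma>: "norm \<sigma> = norm m" and T: "poncelet_triangle (ellipse f g r) a b c" and "\<not> equilateral a b c" for a b c F
  proof -
    have h0: "a + b + c \<noteq> 0"
      using that equil[OF T T T T T T] by blast
    define X where "X = inverse (1 / f + 1 / g)"
    have X: "X * \<sigma> = m" "norm X = 1"
      using \<sigma> m0 by (auto simp: X_def quot norm_divide)
    have "cnj X * cnj \<sigma> = cnj m" "X * cnj X = 1"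
      using X by (metis complex_cnj_mult, simp add: complex_norm_square[symmetric])
    then have Xm: "X * cnj m = cnj \<sigma>"
      by (metis mult.assoc mult_1)
    have "(a + b + c) * X = X * \<sigma> + a * b * c * (X * cnj m)"
      unfolding sums(1)[OF T] by (simp add: algebra_simps)
    also have "\<dots> = a * b + b * c + c * a"
      unfolding sums(2)[OF T] X(1) Xm ..
    finally have "is_X110 a b c F \<longleftrightarrow> (a + b + c) * F = (a + b + c) * X"
      using is_X110_unit_circle[OF poncelet_triangle_unit_circle[OF T] h0] by simp
    then show ?thesis
      using h0 by (simp add: X_def)
  qed
  ultimately show ?thesis
    unfolding sphere by blast
qed

end
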